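(* Let $G$ be a nontrivial connected graph and let $\Gamma$ be a family of nontrivial connected graphs such that $V(F)=V$ for every $F\in\Gamma$. Consider any function $h:E(G)\to\Gamma$. Then $G\otimes_h\Gamma$ is connected if and only if at least one of $G$ or $h(G)$ is nonbipartite.
   Context: All graphs are finite and simple. A graph is nontrivial if it has at least two vertices. Let $G$ be a graph, $\Gamma$ a family of graphs all having the same vertex set $V$, and $h:E(G)\to\Gamma$ a function. The product $G\otimes_h\Gamma$ is the graph with vertex set $V(G)\times V$ in which $(a,x)(b,y)$ is an edge if and only if $ab\in E(G)$ and $xy\in E(h(ab))$. The graph $h(G)$ is the graph with vertex set $V$ and edge set $\bigcup_{e\in E(G)}E(h(e))$. *)

theory Defs
  imports "Graph_Theory.Pair_Digraph" "Graph_Theory.Digraph_Component" "HOL-Library.FuncSet"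
begin

text \<open>
  A finite simple graph is a pair digraph satisfying the locale \<open>pair_graph\<close>: finite, loopless,
  and with a symmetric arc relation. An undirected edge between \<open>a\<close> and \<open>b\<close> is represented in
  \<open>parcs\<close> by both \<open>(a, b)\<close> and \<open>(b, a)\<close>. Connectedness is \<open>Digraph_Component.connected\<close>, which
  also requires the vertex set to be nonempty.
\<close>

definition nontrivial :: "'a pair_pre_digraph \<Rightarrow> bool" where
  "nontrivial G \<longleftrightarrow> card (pverts G) \<ge> 2"

definition bipartite :: "'a pair_pre_digraph \<Rightarrow> bool" where
  "bipartite G \<longleftrightarrow> (\<exists>A B. A \<union> B = pverts G \<and> A \<inter> B = {} \<and>
     (\<forall>(u, v) \<in> parcs G. (u \<in> A \<and> v \<in> B) \<or> (u \<in> B \<and> v \<in> A)))"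

text \<open>
  The undirected edge set. The edge labelling \<open>h\<close> is a function on it, so that both arcs of an
  edge get the same label.
\<close>

definition uedges :: "'a pair_pre_digraph \<Rightarrow> 'a set set" where
  "uedges G = {{a, b} | a b. (a, b) \<in> parcs G}"

text \<open>
  \<open>V\<close> is the common vertex set of the family from which \<open>h\<close> takes its values; the values of \<open>h\<close>
  outside \<open>uedges G\<close> are not used.
\<close>

definition h_product ::
  "'a pair_pre_digraph \<Rightarrow> ('a set \<Rightarrow> 'b pair_pre_digraph) \<Rightarrow> 'b set \<Rightarrow> ('a \<times> 'b) pair_pre_digraph" where
  "h_product G h V = \<lparr> pverts = pverts G \<times> V,
     parcs = {((a, x), (b, y)) | a x b y. (a, b) \<in> parcs G \<and> (x, y) \<in> parcs (h {a, b})} \<rparr>"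

definition h_graph ::
  "'a pair_pre_digraph \<Rightarrow> ('a set \<Rightarrow> 'b pair_pre_digraph) \<Rightarrow> 'b set \<Rightarrow> 'b pair_pre_digraph" where
  "h_graph G h V = \<lparr> pverts = V, parcs = (\<Union>e \<in> uedges G. parcs (h e)) \<rparr>"

lemma pair_graph_iff:
  "pair_graph G \<longleftrightarrow> finite (pverts G) \<and> parcs G \<subseteq> pverts G \<times> pverts G \<and>
     sym (parcs G) \<and> irrefl (parcs G)"
proof
  assume "pair_graph G"
  then interpret pair_graph G .
  show "finite (pverts G) \<and> parcs G \<subseteq> pverts G \<times> pverts G \<and> sym (parcs G) \<and> irrefl (parcs G)"
    using pair_finite_verts pair_sym_arcs pair_no_loops[of "(a, a)" for a]
    by (auto simp: symmetric_def irrefl_def dest: in_arcsD1 in_arcsD2)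
next
  assume A: "finite (pverts G) \<and> parcs G \<subseteq> pverts G \<times> pverts G \<and> sym (parcs G) \<and> irrefl (parcs G)"
  then have "finite (parcs G)"
    by (meson finite_SigmaI finite_subset)
  with A show "pair_graph G"
    by unfold_locales (auto simp: symmetric_def irrefl_def)
qed

lemma
  assumes G: "pair_graph G"
    and \<Gamma>: "\<And>F. F \<in> \<Gamma> \<Longrightarrow> pair_graph F" "\<And>F. F \<in> \<Gamma> \<Longrightarrow> pverts F = V"
    and V: "finite V"
    and h: "h \<in> uedges G \<rightarrow> \<Gamma>"
  shows pair_graph_h_product: "pair_graph (h_product G h V)"
    and pair_graph_h_graph: "pair_graph (h_graph G h V)"
proof -
  have F: "parcs (h e) \<subseteq> V \<times> V \<and> sym (parcs (h e)) \<and> irrefl (parcs (h e))" if "e \<in> uedges G" for e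
    using \<Gamma> h that pair_graph_iff by (metis PiE)
  have E: "{a, b} \<in> uedges G" if "(a, b) \<in> parcs G" for a b
    using that by (auto simp: uedges_def)
  have G': "finite (pverts G)" "parcs G \<subseteq> pverts G \<times> pverts G" "sym (parcs G)" "irrefl (parcs G)"
    using G by (auto simp: pair_graph_iff)
  have F1: "x \<in> V \<and> y \<in> V \<and> (y, x) \<in> parcs (h e)" and F2: "(x, x) \<notin> parcs (h e)"
    if "e \<in> uedges G" "(x, y) \<in> parcs (h e)" for e x y
    using F[OF that(1)] that(2) by (auto dest: symD simp: irrefl_def)
  have 1: "parcs (h_product G h V) \<subseteq> pverts (h_product G h V) \<times> pverts (h_product G h V)"
    unfolding h_product_def using G'(2) F1[OF E] by auto
  have 2: "sym (parcs (h_product G h V))"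
    unfolding h_product_def
    by (rule symI) (auto simp: insert_commute dest: symD[OF G'(3)] F1[OF E])
  have 3: "irrefl (parcs (h_product G h V))"
    using G'(4) by (auto simp: irrefl_def h_product_def)
  show "pair_graph (h_product G h V)"
    unfolding pair_graph_iff using 1 2 3 G'(1) V by (simp add: h_product_def)
  have 4: "parcs (h_graph G h V) \<subseteq> V \<times> V"
    unfolding h_graph_def using F1 by auto
  have 5: "sym (parcs (h_graph G h V))"
    unfolding h_graph_def by (rule symI) (auto dest: F1)
  have 6: "irrefl (parcs (h_graph G h V))"
    using F2 by (auto simp: irrefl_def h_graph_def)
  show "pair_graph (h_graph G h V)"
    unfolding pair_graph_iff using 4 5 6 V by (simp add: h_graph_def)
qed

end

theory Submission
  imports Defs
begin

text \<open>
  If \<open>G\<close> and \<open>h(G)\<close> are properly 2-coloured by \<open>c\<close> and \<open>d\<close>, then \<open>c a = d x\<close> is an invariant of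
  the components of the product, and it takes both values on each fibre \<open>{a} \<times> V\<close>.

  Conversely, let \<open>ab\<close> be an edge of \<open>G\<close>. Following a walk of \<open>h(ab)\<close> while alternating between
  \<open>a\<close> and \<open>b\<close> shows that each \<open>(a, z)\<close> is joined to \<open>(a, x)\<close> or to \<open>(b, x)\<close>. Hence if \<open>(a, x)\<close> and
  \<open>(b, x)\<close> are ever joined, the whole fibre over \<open>a\<close> lies in one component, and so does the whole
  product. If the product is disconnected, it therefore has exactly two components, and moving from
  \<open>(a, x)\<close> to \<open>(b, x)\<close> always changes the component. Restricting the colouring by components to
  \<open>V(G) \<times> {x}\<close> and to \<open>{a} \<times> V\<close> gives proper 2-colourings of \<open>G\<close> and of \<open>h(G)\<close>.
\<close>

text \<open>\<open>connected\<close> asks for strong connectivity of the symmetric closure. The arcs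
  are already symmetric, so the closure changes nothing.\<close>

lemma connected_iff_rtrancl:
  assumes "pair_graph G"
  shows "Digraph_Component.connected (with_proj G) \<longleftrightarrow>
    pverts G \<noteq> {} \<and> (\<forall>u \<in> pverts G. \<forall>v \<in> pverts G. (u, v) \<in> (parcs G)\<^sup>*)"
proof -
  interpret pair_graph G by fact
  have "u \<rightarrow>\<^sup>*\<^bsub>with_proj (mk_symmetric G)\<^esub> v \<longleftrightarrow> (u, v) \<in> (parcs G)\<^sup>*" if "u \<in> pverts G" for u v
    using that reachable_mk_symmetric_eq[OF sym_arcs] reachable_conv' by simp
  then show ?thesis
    by (auto simp: Digraph_Component.connected_def strongly_connected_def)
qed

lemma connected_nontrivial_neighbour:
  assumes "pair_graph G" "nontrivial G" "Digraph_Component.connected (with_proj G)" "u \<in> pverts G"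
  obtains v where "(u, v) \<in> parcs G"
proof -
  have "\<not> pverts G \<subseteq> {u}"
    using assms(2) card_mono[of "{u}" "pverts G"] by (auto simp: nontrivial_def)
  then obtain w where "w \<in> pverts G" "w \<noteq> u"
    by blast
  moreover from this have "(u, w) \<in> (parcs G)\<^sup>*"
    using assms by (simp add: connected_iff_rtrancl)
  ultimately show thesis
    using that by (metis converse_rtranclE)
qed

lemma bipartite_iff_colouring:
  assumes "parcs G \<subseteq> pverts G \<times> pverts G"
  shows "bipartite G \<longleftrightarrow> (\<exists>c :: 'a \<Rightarrow> bool. \<forall>(u, v) \<in> parcs G. c u \<noteq> c v)"
proof
  assume "bipartite G"
  then obtain A B where "A \<inter> B = {}"
    and "\<forall>(u, v) \<in> parcs G. (u \<in> A \<and> v \<in> B) \<or> (u \<in> B \<and> v \<in> A)"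
    unfolding bipartite_def by blast
  then have "\<forall>(u, v) \<in> parcs G. (u \<in> A) \<noteq> (v \<in> A)"
    by blast
  then show "\<exists>c :: 'a \<Rightarrow> bool. \<forall>(u, v) \<in> parcs G. c u \<noteq> c v"
    by (rule exI[of _ "\<lambda>v. v \<in> A"])
next
  assume "\<exists>c :: 'a \<Rightarrow> bool. \<forall>(u, v) \<in> parcs G. c u \<noteq> c v"
  then obtain c :: "'a \<Rightarrow> bool" where "\<forall>(u, v) \<in> parcs G. c u \<noteq> c v" ..
  with assms show "bipartite G"
    unfolding bipartite_def
    by (intro exI[of _ "{v \<in> pverts G. c v}"] exI[of _ "{v \<in> pverts G. \<not> c v}"]) auto
qed

text \<open>The family enters the product and \<open>h_graph\<close> through the labels
  \<open>h {a, b}\<close> of edges, so its properties are stated for these graphs directly.\<close>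

locale edge_labelled_graph =
  fixes G :: "'a pair_pre_digraph"
    and V :: "'b set"
    and h :: "'a set \<Rightarrow> 'b pair_pre_digraph"
  assumes graph: "pair_graph G" "nontrivial G" "Digraph_Component.connected (with_proj G)"
    and label: "\<And>a b. (a, b) \<in> parcs G \<Longrightarrow> pair_graph (h {a, b}) \<and> nontrivial (h {a, b}) \<and>
      Digraph_Component.connected (with_proj (h {a, b})) \<and> pverts (h {a, b}) = V"
begin

abbreviation P :: "(('a \<times> 'b) \<times> ('a \<times> 'b)) set" where
  "P \<equiv> parcs (h_product G h V)"

lemma label_uedge:
  assumes "e \<in> uedges G"
  shows "pair_graph (h e)" "pverts (h e) = V"
  using assms label by (auto simp: uedges_def)

lemma ex_edge:
  obtains a b where "(a, b) \<in> parcs G"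
proof -
  obtain a where "a \<in> pverts G"
    using graph by (auto simp: connected_iff_rtrancl)
  with connected_nontrivial_neighbour[OF graph] that show thesis
    by blast
qed

lemma product_graph: "pair_graph (h_product G h V)"
  and union_graph: "pair_graph (h_graph G h V)"
proof -
  obtain a b where "(a, b) \<in> parcs G"
    by (rule ex_edge)
  then have "finite V"
    using label pair_graph_iff by metis
  \<comment> \<open>The set of labels that occur on edges serves as the family.\<close>
  have labels: "h \<in> uedges G \<rightarrow> h ` uedges G"
    by simp
  show "pair_graph (h_product G h V)"
    by (rule pair_graph_h_product[OF graph(1) _ _ \<open>finite V\<close> labels]) (use label_uedge in blast)+
  show "pair_graph (h_graph G h V)"
    by (rule pair_graph_h_graph[OF graph(1) _ _ \<open>finite V\<close> labels]) (use label_uedge in blast)+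
qed

lemma parcs_sym: "(a, b) \<in> parcs G \<Longrightarrow> (b, a) \<in> parcs G"
  using graph(1) by (meson pair_graph_iff symD)

lemma parcs_verts: "(a, b) \<in> parcs G \<Longrightarrow> a \<in> pverts G \<and> b \<in> pverts G"
  using graph(1) by (auto simp: pair_graph_iff)

lemma mem_P: "((a, x), (b, y)) \<in> P \<longleftrightarrow> (a, b) \<in> parcs G \<and> (x, y) \<in> parcs (h {a, b})"
  by (auto simp: h_product_def)

lemma P_rtrancl_sym: "(p, q) \<in> P\<^sup>* \<Longrightarrow> (q, p) \<in> P\<^sup>*"
  using product_graph by (metis pair_graph_iff sym_rtrancl symD)

lemma connected_product_iff:
  "Digraph_Component.connected (with_proj (h_product G h V)) \<longleftrightarrow>
    pverts G \<times> V \<noteq> {} \<and> (\<forall>p \<in> pverts G \<times> V. \<forall>q \<in> pverts G \<times> V. (p, q) \<in> P\<^sup>*)"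
  using connected_iff_rtrancl[OF product_graph] by (simp add: h_product_def)

lemma V_nonempty: "V \<noteq> {}"
proof -
  obtain a b where "(a, b) \<in> parcs G"
    by (rule ex_edge)
  from label[OF this] show ?thesis
    by (auto simp: nontrivial_def)
qed

lemma not_connected_if_bipartite:
  assumes "bipartite G" "bipartite (h_graph G h V)"
  shows "\<not> Digraph_Component.connected (with_proj (h_product G h V))"
proof
  assume conn: "Digraph_Component.connected (with_proj (h_product G h V))"
  obtain c :: "'a \<Rightarrow> bool" where c: "\<And>a b. (a, b) \<in> parcs G \<Longrightarrow> c a \<noteq> c b"
    using assms(1) graph(1) by (auto simp: bipartite_iff_colouring pair_graph_iff)
  obtain d :: "'b \<Rightarrow> bool" where "\<forall>(x, y) \<in> parcs (h_graph G h V). d x \<noteq> d y"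
    using assms(2) union_graph bipartite_iff_colouring pair_graph_iff by metis
  then have d: "d x \<noteq> d y" if "(a, b) \<in> parcs G" "(x, y) \<in> parcs (h {a, b})" for a b x y
    using that by (auto simp: h_graph_def uedges_def)
  \<comment> \<open>An arc of the product flips both colours, so their agreement is
    preserved.\<close>
  have inv: "(c (fst p) = d (snd p)) = (c (fst q) = d (snd q))" if "(p, q) \<in> P\<^sup>*" for p q
    using that
  proof induction
    case (step q r)
    then show ?case
      using c d by (cases q, cases r) (fastforce simp: mem_P)
  qed simp
  obtain a b where ab: "(a, b) \<in> parcs G"
    by (rule ex_edge)
  obtain x where "x \<in> V"
    using V_nonempty by blast
  then obtain y where xy: "(x, y) \<in> parcs (h {a, b})"
    using label[OF ab] connected_nontrivial_neighbour by metis
  then have "y \<in> V"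
    using label[OF ab] by (auto simp: pair_graph_iff)
  \<comment> \<open>These two vertices share the first colour, but their second colours differ
    because \<open>(x, y)\<close> is an arc of a label.\<close>
  then have "((a, x), (a, y)) \<in> P\<^sup>*"
    using conn ab \<open>x \<in> V\<close> parcs_verts by (auto simp: connected_product_iff)
  from inv[OF this] d[OF ab xy] show False
    by auto
qed

lemma edge_fibre:
  assumes ab: "(a, b) \<in> parcs G" and "x \<in> V" "z \<in> V"
  shows "((a, x), (a, z)) \<in> P\<^sup>* \<or> ((b, x), (a, z)) \<in> P\<^sup>*"
proof -
  have "(x, z) \<in> (parcs (h {a, b}))\<^sup>*"
    using label[OF ab] assms by (auto simp: connected_iff_rtrancl)
  \<comment> \<open>Each step swaps \<open>a\<close> and \<open>b\<close>, so the induction follows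
    both lifts of the walk, the one from \<open>(a, x)\<close> and the one from
    \<open>(b, x)\<close>. The two alternatives are the parities of its length.\<close>
  then have "(((a, x), (a, z)) \<in> P\<^sup>* \<and> ((b, x), (b, z)) \<in> P\<^sup>*) \<or>
    (((b, x), (a, z)) \<in> P\<^sup>* \<and> ((a, x), (b, z)) \<in> P\<^sup>*)"
  proof induction
    case (step y z)
    then have "((a, y), (b, z)) \<in> P" "((b, y), (a, z)) \<in> P"
      using ab parcs_sym by (auto simp: mem_P insert_commute)
    with step.IH show ?case
      by (meson rtrancl_into_rtrancl)
  qed simp
  then show ?thesis
    by blast
qed

text \<open>A walk of \<open>G\<close> can be lifted backwards from a prescribed end: each vertex of
  a label has a neighbour there, which supplies the previous second coordinate. The start
  \<open>x\<close> cannot be prescribed.\<close>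

lemma reach_fibre:
  assumes "a \<in> pverts G" "b \<in> pverts G" "y \<in> V"
  obtains x where "x \<in> V" "((a, x), (b, y)) \<in> P\<^sup>*"
proof -
  have "(a, b) \<in> (parcs G)\<^sup>*"
    using assms graph by (simp add: connected_iff_rtrancl)
  then have "\<forall>y \<in> V. \<exists>x \<in> V. ((a, x), (b, y)) \<in> P\<^sup>*"
  proof induction
    case (step b c)
    show ?case
    proof
      fix y assume "y \<in> V"
      then obtain w where w: "(y, w) \<in> parcs (h {b, c})"
        using label[OF step.hyps(2)] connected_nontrivial_neighbour by metis
      then have "w \<in> V" "(w, y) \<in> parcs (h {b, c})"
        using label[OF step.hyps(2)] by (auto simp: pair_graph_iff intro: symD)
      with step show "\<exists>x \<in> V. ((a, x), (c, y)) \<in> P\<^sup>*"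
        by (meson mem_P rtrancl_into_rtrancl)
    qed
  qed auto
  with assms(3) that show thesis
    by blast
qed

lemma connected_if_fibre:
  assumes "a \<in> pverts G" and fibre: "\<And>z. z \<in> V \<Longrightarrow> ((a, x), (a, z)) \<in> P\<^sup>*"
  shows "Digraph_Component.connected (with_proj (h_product G h V))"
proof -
  have *: "((a, x), q) \<in> P\<^sup>*" if q: "q \<in> pverts G \<times> V" for q
  proof -
    obtain b y where "q = (b, y)" "b \<in> pverts G" "y \<in> V"
      using q by blast
    with reach_fibre[OF assms(1)] fibre show ?thesis
      by (metis rtrancl_trans)
  qed
  show ?thesis
    unfolding connected_product_iff
    using assms(1) V_nonempty * P_rtrancl_sym by (blast intro: rtrancl_trans)
qed

lemma bipartite_if_not_connected:
  assumes disc: "\<not> Digraph_Component.connected (with_proj (h_product G h V))"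
  shows "bipartite G" "bipartite (h_graph G h V)"
proof -
  have switch: "((a, x), (b, x)) \<notin> P\<^sup>*" if "(a, b) \<in> parcs G" "x \<in> V" for a b x
  proof
    assume "((a, x), (b, x)) \<in> P\<^sup>*"
    then have "((a, x), (a, z)) \<in> P\<^sup>*" if "z \<in> V" for z
      using edge_fibre[OF \<open>(a, b) \<in> parcs G\<close> \<open>x \<in> V\<close> that] by (meson rtrancl_trans)
    with disc connected_if_fibre parcs_verts that show False
      by metis
  qed
  obtain a0 b0 where ab0: "(a0, b0) \<in> parcs G"
    by (rule ex_edge)
  obtain x0 where x0: "x0 \<in> V"
    using V_nonempty by blast
  define c where "c p \<longleftrightarrow> ((a0, x0), p) \<in> P\<^sup>*" for p
  \<comment> \<open>At most two components exist: \<open>p\<close> is reached from the fibre over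
    \<open>a0\<close>, and by \<open>edge_fibre\<close> every vertex of that fibre is reached from
    \<open>(a0, x0)\<close> or \<open>(b0, x0)\<close>.\<close>
  have other: "((b0, x0), p) \<in> P\<^sup>*" if p: "\<not> c p" "p \<in> pverts G \<times> V" for p
  proof -
    obtain x where "x \<in> V" "((a0, x), p) \<in> P\<^sup>*"
      using p(2) reach_fibre parcs_verts[OF ab0] by (metis mem_Sigma_iff prod.collapse)
    with edge_fibre[OF ab0 x0 \<open>x \<in> V\<close>] p(1) show ?thesis
      unfolding c_def by (meson rtrancl_trans)
  qed
  have c_iff: "c p = c q \<longleftrightarrow> (p, q) \<in> P\<^sup>*" if pq: "p \<in> pverts G \<times> V" "q \<in> pverts G \<times> V" for p q
  proof
    assume "c p = c q"
    \<comment> \<open>The common root \<open>r\<close> is \<open>(a0, x0)\<close> or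
      \<open>(b0, x0)\<close>, according to the shared value of \<open>c\<close>.\<close>
    then obtain r where "(r, p) \<in> P\<^sup>*" "(r, q) \<in> P\<^sup>*"
      using other pq unfolding c_def by metis
    then show "(p, q) \<in> P\<^sup>*"
      using P_rtrancl_sym by (meson rtrancl_trans)
  next
    assume "(p, q) \<in> P\<^sup>*"
    then show "c p = c q"
      unfolding c_def using P_rtrancl_sym by (meson rtrancl_trans)
  qed
  have c_switch: "c (a, x) \<noteq> c (b, x)" if "(a, b) \<in> parcs G" "x \<in> V" for a b x
    using that switch parcs_verts by (simp add: c_iff)
  then have "\<forall>(a, b) \<in> parcs G. c (a, x0) \<noteq> c (b, x0)"
    using x0 by blast
  then have "\<exists>d :: 'a \<Rightarrow> bool. \<forall>(a, b) \<in> parcs G. d a \<noteq> d b"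
    by (rule exI[of _ "\<lambda>a. c (a, x0)"])
  then show "bipartite G"
    using graph(1) bipartite_iff_colouring pair_graph_iff by metis
  \<comment> \<open>Crossing an edge of \<open>G\<close> flips \<open>c\<close> at both
    \<open>x\<close> and \<open>y\<close>, so whether they agree is the same in every fibre. This
    carries edges of all labels to the single fibre over \<open>a0\<close>.\<close>
  have same: "(c (a0, x) = c (a0, y)) = (c (a, x) = c (a, y))"
    if "a \<in> pverts G" "x \<in> V" "y \<in> V" for a x y
  proof -
    have "(a0, a) \<in> (parcs G)\<^sup>*"
      using that graph parcs_verts[OF ab0] by (simp add: connected_iff_rtrancl)
    then show ?thesis
    proof induction
      case (step a b)
      then show ?case
        using c_switch that by metis
    qed simp
  qed
  have "c (a0, x) \<noteq> c (a0, y)" if ab: "(a, b) \<in> parcs G" and xy: "(x, y) \<in> parcs (h {a, b})"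
    for a b x y
  proof -
    have V: "x \<in> V" "y \<in> V"
      using label[OF ab] xy by (auto simp: pair_graph_iff)
    \<comment> \<open>Adjacent vertices of the product share a component; switching from
      \<open>(b, y)\<close> to \<open>(a, y)\<close> then changes the colour.\<close>
    have "c (a, x) = c (b, y)"
      using ab xy V parcs_verts by (simp add: c_iff mem_P r_into_rtrancl)
    with c_switch[OF ab V(2)] same[OF _ V] parcs_verts[OF ab] show ?thesis
      by metis
  qed
  then have "\<forall>(x, y) \<in> parcs (h_graph G h V). c (a0, x) \<noteq> c (a0, y)"
    by (auto simp: h_graph_def uedges_def)
  then have "\<exists>d :: 'b \<Rightarrow> bool. \<forall>(x, y) \<in> parcs (h_graph G h V). d x \<noteq> d y"
    by (rule exI[of _ "\<lambda>x. c (a0, x)"])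
  then show "bipartite (h_graph G h V)"
    using union_graph bipartite_iff_colouring pair_graph_iff by metis
qed

end

theorem theorem2p1:
  fixes G :: "'a pair_pre_digraph"
    and V :: "'b set"
    and \<Gamma> :: "'b pair_pre_digraph set"
    and h :: "'a set \<Rightarrow> 'b pair_pre_digraph"
  assumes "pair_graph G" "nontrivial G" "Digraph_Component.connected (with_proj G)"
    and "\<And>F. F \<in> \<Gamma> \<Longrightarrow> pair_graph F \<and> nontrivial F \<and> Digraph_Component.connected (with_proj F)"
    and "\<And>F. F \<in> \<Gamma> \<Longrightarrow> pverts F = V"
    and "h \<in> uedges G \<rightarrow> \<Gamma>"
  shows "Digraph_Component.connected (with_proj (h_product G h V)) \<longleftrightarrow>
    \<not> bipartite G \<or> \<not> bipartite (h_graph G h V)"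
proof -
  have "h {a, b} \<in> \<Gamma>" if "(a, b) \<in> parcs G" for a b
    using assms(6) that by (auto simp: uedges_def)
  then interpret edge_labelled_graph G V h
    using assms by (intro edge_labelled_graph.intro) auto
  show ?thesis
    using not_connected_if_bipartite bipartite_if_not_connected by blast
qed

end
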